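(* The following inclusions hold: $$\lambda K(f)\subset K(f)\subset \bigcup_{n\in\mathbb N}\frac{K(f)}{\lambda^n}\subset \bigcap_{n\in\mathbb N}\lambda^n\widehat W\subset \widehat W\subset \frac{\widehat W}{\lambda}.$$
   Context: Let $\ell\geq 2$ be an even integer. Let $f$ be the real analytic function which near $0$ coincides with the real fixed point of period-doubling renormalization with critical point of degree $\ell$. With $\lambda=-f(f(0))\in(0,1)$, it satisfies the Cvitanović–Feigenbaum equation: $f(z)=-\frac1\lambda f(f(\lambda z))$ near $0$; $f(0)=1$; and $f(z)=F(z^\ell)$, where $F^{-1}$ is defined and univalent on $\mathbb C_\lambda=\mathbb C\setminus(]-\infty,-1/\lambda]\cup[1/\lambda^2,+\infty[)$. Put $\mathcal W=F^{-1}(\mathbb C_\lambda)$ and $W=\{z\in\mathbb C: z^\ell\in\mathcal W\}$. Then $f:W\to\mathbb C_\lambda$, $f(z)=F(z^\ell)$, is a polynomial-like map of degree $\ell$. $K(f)$ denotes its (filled) Julia set, i.e. the set of points of $W$ all of whose iterates under $f:W\to\mathbb C_\lambda$ stay in $W$ (it has empty interior, so Julia set and filled Julia set coincide). An analytic extension of $f$ is a holomorphic function on a connected open subset of $\mathbb C$ which agrees with $f$ on some nonempty open set. It is known that $f$ has a unique maximal analytic extension $\hat f:\widehat W\to\mathbb C$, i.e. one of which all analytic extensions are restrictions, and that $\widehat W$ is a simply connected open subset of $\mathbb C$. For a set $A\subset\mathbb C$, $\lambda^nA=\{\lambda^n z: z\in A\}$ and $A/\lambda^n=\{z/\lambda^n: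 z\in A\}$. Here $\subset$ allows equality. *)

theory Defs
  imports "HOL-Complex_Analysis.Complex_Analysis"
begin

definition slit_plane :: "real \<Rightarrow> complex set" where
  "slit_plane lam = - (complex_of_real ` {.. - 1 / lam} \<union> complex_of_real ` {1 / lam\<^sup>2 ..})"

text \<open>
  \<open>G\<close> plays the role of \<open>F\<inverse>\<close>, the inverse branch sending \<open>1\<close> to \<open>0\<close>, so \<open>G ` slit_plane lam\<close> is
  \<open>F\<inverse>(\<complex>\<^sub>\<lambda>)\<close>.
\<close>
definition pl_domain :: "nat \<Rightarrow> real \<Rightarrow> (complex \<Rightarrow> complex) \<Rightarrow> complex set" where
  "pl_domain d lam G = {z. z ^ d \<in> G ` slit_plane lam}"

text \<open>
  \<open>f\<close> is the fixed point of period-doubling renormalization with critical point of degree \<open>d\<close>: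
  a real analytic self-map of \<open>[-1, 1]\<close>, identified with its holomorphic extension
  \<open>z \<mapsto> F (z ^ d)\<close> to \<open>pl_domain d lam G\<close>, which is a neighbourhood of \<open>0\<close> because \<open>G 1 = 0\<close>. Real
  analyticity on \<open>[-1, 1]\<close> is what gives \<open>f (f 0) = f 1\<close> a meaning. Outside \<open>[-1, 1]\<close> and
  \<open>pl_domain d lam G\<close> the values of \<open>f\<close> are irrelevant, and so are those of \<open>F\<close> outside
  \<open>G ` slit_plane lam\<close>.
\<close>
definition period_doubling_fixed_point ::
    "nat \<Rightarrow> real \<Rightarrow> (complex \<Rightarrow> complex) \<Rightarrow> (complex \<Rightarrow> complex) \<Rightarrow> (complex \<Rightarrow> complex) \<Rightarrow> bool" where
  "period_doubling_fixed_point d lam f F G \<longleftrightarrow>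
     f analytic_on complex_of_real ` {-1..1} \<and>
     f ` (complex_of_real ` {-1..1}) \<subseteq> complex_of_real ` {-1..1} \<and>
     complex_of_real lam = - f (f 0) \<and> 0 < lam \<and> lam < 1 \<and>
     (\<forall>\<^sub>F z in nhds 0. f z = - (1 / complex_of_real lam) * f (f (complex_of_real lam * z))) \<and>
     f 0 = 1 \<and>
     (\<forall>z \<in> pl_domain d lam G. f z = F (z ^ d)) \<and>
     G holomorphic_on slit_plane lam \<and> inj_on G (slit_plane lam) \<and>
     (\<forall>w \<in> slit_plane lam. F (G w) = w) \<and> G 1 = 0"

definition filled_julia :: "complex set \<Rightarrow> (complex \<Rightarrow> complex) \<Rightarrow> complex set" where
  "filled_julia W f = {z. \<forall>n. (f ^^ n) z \<in> W}"

text \<open>\<open>W\<close> is the domain on which the total function \<open>f\<close> is meaningful.\<close>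
definition analytic_extension ::
    "complex set \<Rightarrow> (complex \<Rightarrow> complex) \<Rightarrow> complex set \<Rightarrow> (complex \<Rightarrow> complex) \<Rightarrow> bool" where
  "analytic_extension W f U g \<longleftrightarrow>
     open U \<and> connected U \<and> g holomorphic_on U \<and>
     (\<exists>V. open V \<and> V \<noteq> {} \<and> V \<subseteq> U \<inter> W \<and> (\<forall>z \<in> V. g z = f z))"

definition maximal_analytic_extension ::
    "complex set \<Rightarrow> (complex \<Rightarrow> complex) \<Rightarrow> complex set \<Rightarrow> (complex \<Rightarrow> complex) \<Rightarrow> bool" where
  "maximal_analytic_extension W f Wh fh \<longleftrightarrow>
     analytic_extension W f Wh fh \<and>
     (\<forall>U g. analytic_extension W f U g \<longrightarrow> U \<subseteq> Wh \<and> (\<forall>z \<in> U. g z = fh z))"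

end

theory Submission imports Defs begin

text \<open>
  Put \<open>G = F\<inverse>\<close> on the slit plane \<open>S = \<complex>\<^sub>\<lambda>\<close>. Since \<open>G (-\<lambda> w)\<close> has no zero on \<open>S\<close>, it has a
  holomorphic \<open>d\<close>-th root \<open>H\<close> with \<open>H 1 = 1\<close>, and the fixed point equation becomes
  \<open>G (H w) = \<lambda>^d G w\<close>. A monotonicity argument on the real axis shows \<open>H S \<subseteq> S\<close> and \<open>W \<subseteq> S\<close>; hence
  \<open>\<lambda> W \<subseteq> W\<close>, \<open>f (\<lambda> W) \<subseteq> W\<close> and \<open>f (f (\<lambda> z)) = -\<lambda> f z\<close> on all of \<open>W\<close>.

  Let \<open>V m\<close> be the domain of \<open>f ^^ m\<close>. Then \<open>\<lambda> V m \<subseteq> V (2 m)\<close>, which gives \<open>\<lambda> K \<subseteq> K\<close>, and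
  \<open>(-\<lambda>)^(-n) (f ^^ (2 ^ n)) (\<lambda>^n z)\<close> extends \<open>f\<close> analytically to the connected set
  \<open>U n = V (2 ^ n) / \<lambda>^n\<close>. Properness of \<open>f ^^ m : V m \<rightarrow> S\<close> shows that the increasing union of
  the \<open>U n\<close> is the whole maximal domain, and \<open>\<lambda> U (n + 1) \<subseteq> U n\<close>.
\<close>

section \<open>Properness and connectedness for power maps\<close>

text \<open>This is properness of \<open>z ^ n\<close>: if the values converge, the points stay
  bounded.\<close>

lemma power_convergent_subsequence:
  fixes x :: "nat \<Rightarrow> complex"
  assumes lim: "(\<lambda>k. x k ^ n) \<longlonglongrightarrow> a" and n: "0 < n"
  obtains q r where "strict_mono (r :: nat \<Rightarrow> nat)" "(x \<circ> r) \<longlonglongrightarrow> q" "q ^ n = a"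
proof -
  have "bounded (range (\<lambda>k. x k ^ n))" using lim convergent_imp_bounded by blast
  then obtain B where B: "\<And>k. norm (x k) ^ n \<le> B"
    unfolding bounded_iff by (auto simp: norm_power)
  have "norm (x k) \<le> max 1 B" for k
  proof (cases "norm (x k) \<le> 1")
    case False
    then have "norm (x k) ^ 1 \<le> norm (x k) ^ n" using n by (intro power_increasing) auto
    then show ?thesis using B[of k] by auto
  qed simp
  then have "bounded (range x)" unfolding bounded_iff by blast
  then obtain q r where q: "strict_mono (r :: nat \<Rightarrow> nat)" "(x \<circ> r) \<longlonglongrightarrow> q"
    using bounded_imp_convergent_subsequence by blast
  have "(\<lambda>k. (x \<circ> r) k ^ n) \<longlonglongrightarrow> a"
    using LIMSEQ_subseq_LIMSEQ[OF lim q(1)] by (simp add: o_def)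
  then have "q ^ n = a" using tendsto_power[OF q(2), of n] LIMSEQ_unique by blast
  then show ?thesis using that q by blast
qed

text \<open>A nonempty open and relatively closed piece of the preimage maps onto \<open>A\<close>:
  its image is open by the open mapping theorem and closed in \<open>A\<close> by properness. So
  each piece contains \<open>0\<close>, the only root of \<open>0\<close>, and there cannot be
  two.\<close>

lemma connected_power_preimage:
  fixes A :: "complex set"
  assumes "open A" "connected A" "0 \<in> A" and n: "0 < n"
  shows "connected {z. z ^ n \<in> A}"
proof -
  let ?X = "{z. z ^ n \<in> A}"
  have "open ?X"
    using open_vimage[OF \<open>open A\<close>, of "\<lambda>z. z ^ n"]
    by (simp add: vimage_def continuous_on_power)
  have img: "0 \<in> P"
    if P: "open P" "P \<noteq> {}" "P \<subseteq> ?X" and Q: "open Q" "P \<inter> Q = {}" "?X \<subseteq> P \<union> Q" for P Q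
  proof -
    let ?p = "\<lambda>z::complex. z ^ n"
    have "\<not> ?p constant_on UNIV"
    proof
      assume "?p constant_on UNIV"
      then have "(0::complex) ^ n = 1 ^ n" unfolding constant_on_def by (metis UNIV_I)
      then show False using zero_power[OF n] by (metis power_one zero_neq_one)
    qed
    then have op: "open (?p ` P)"
      by (intro open_mapping_thm[of ?p UNIV]) (use P in \<open>auto intro!: holomorphic_intros\<close>)
    have "?p ` P = A"
    \<comment> \<open>\<open>GPicard2\<close> is the clopen criterion: a nonempty open subset of a
      connected set that contains its limit points there is the whole set.\<close>
    proof (rule GPicard2)
      show "?p ` P \<subseteq> A" "?p ` P \<noteq> {}" using P by auto
      fix a assume lim: "a islimpt ?p ` P" and a: "a \<in> A"
      then obtain s where s: "\<And>k. s k \<in> ?p ` P" "s \<longlonglongrightarrow> a"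
        unfolding islimpt_sequential by blast
      then have "\<forall>k. \<exists>z. z \<in> P \<and> s k = z ^ n" by blast
      then obtain x where x: "\<And>k. x k \<in> P" "\<And>k. s k = x k ^ n"
        using choice[of "\<lambda>k z. z \<in> P \<and> s k = z ^ n"] by blast
      have "(\<lambda>k. x k ^ n) \<longlonglongrightarrow> a" using s(2) by (simp add: x(2)[symmetric])
      then obtain q r where q: "(x \<circ> r) \<longlonglongrightarrow> q" and qa: "q ^ n = a"
        using power_convergent_subsequence n by blast
      have "q \<notin> Q"
      proof
        assume "q \<in> Q"
        then have "eventually (\<lambda>k. (x \<circ> r) k \<in> Q) sequentially"
          using q Q(1) topological_tendstoD by blast
        then obtain k where "(x \<circ> r) k \<in> Q" by (auto simp: eventually_sequentially)
        then show False using x(1) Q(2) by auto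
      qed
      then show "a \<in> ?p ` P" using qa a Q(3) by auto
    qed (use op \<open>connected A\<close> in auto)
    with \<open>0 \<in> A\<close> obtain z where "z \<in> P" "z ^ n = 0" by auto
    then show "0 \<in> P" by simp
  qed
  show ?thesis
  proof (rule ccontr)
    assume "\<not> connected ?X"
    then obtain P Q where PQ: "open P" "open Q" "?X \<subseteq> P \<union> Q" "P \<inter> Q \<inter> ?X = {}"
      "P \<inter> ?X \<noteq> {}" "Q \<inter> ?X \<noteq> {}" unfolding connected_def by auto
    have "0 \<in> P \<inter> ?X" by (rule img[of _ "Q \<inter> ?X"]) (use PQ \<open>open ?X\<close> in auto)
    moreover have "0 \<in> Q \<inter> ?X" by (rule img[of _ "P \<inter> ?X"]) (use PQ \<open>open ?X\<close> in auto)
    ultimately show False using PQ by auto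
  qed
qed

text \<open>\<open>a / b\<close> is eventually an \<open>n\<close>-th root of unity and tends to
  \<open>1\<close>, while the roots of unity are isolated.\<close>

lemma eventually_eq_of_power_eq:
  fixes a b :: "'a \<Rightarrow> complex"
  assumes a: "(a \<longlongrightarrow> 1) X" and b: "(b \<longlongrightarrow> 1) X" and n: "0 < n"
    and ab: "eventually (\<lambda>z. a z ^ n = b z ^ n) X"
  shows "eventually (\<lambda>z. a z = b z) X"
proof -
  let ?R = "{z::complex. z ^ n = 1} - {1}"
  have "finite ?R" using n finite_roots_unity[of n] by auto
  then have "open (- ?R)" using finite_imp_closed open_Compl by blast
  moreover have "((\<lambda>z. a z / b z) \<longlongrightarrow> 1) X" using tendsto_divide[OF a b] by simp
  ultimately have "eventually (\<lambda>z. a z / b z \<in> - ?R) X" using topological_tendstoD by fastforce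
  moreover have "eventually (\<lambda>z. b z \<noteq> 0) X" using b tendsto_imp_eventually_ne by fastforce
  ultimately show ?thesis using ab
    by eventually_elim (auto simp: power_divide)
qed

section \<open>The slit plane and the polynomial-like map\<close>

lemma mem_slit_plane:
  "z \<in> slit_plane lam \<longleftrightarrow> Im z \<noteq> 0 \<or> - 1 / lam < Re z \<and> Re z < 1 / lam\<^sup>2"
  by (auto simp: slit_plane_def complex_eq_iff image_iff Bex_def not_le)

locale period_doubling =
  fixes d :: nat and lam :: real and f F G :: "complex \<Rightarrow> complex"
  assumes d2: "2 \<le> d" and even_d: "even d"
    and fixed_point: "period_doubling_fixed_point d lam f F G"
begin

abbreviation L :: complex where "L \<equiv> of_real lam"
abbreviation S :: "complex set" where "S \<equiv> slit_plane lam"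
abbreviation W :: "complex set" where "W \<equiv> pl_domain d lam G"
abbreviation I :: "real set" where "I \<equiv> {- 1 / lam <..< 1 / lam\<^sup>2}"

lemma
  shows f_analytic: "f analytic_on complex_of_real ` {-1..1}"
    and f_real: "f ` (complex_of_real ` {-1..1}) \<subseteq> complex_of_real ` {-1..1}"
    and lam: "0 < lam" "lam < 1"
    and f_equation: "\<forall>\<^sub>F z in nhds 0. f z = - (1 / L) * f (f (L * z))"
    and f_0 [simp]: "f 0 = 1"
    and f_1: "f 1 = - L"
    and f_W: "\<And>z. z \<in> W \<Longrightarrow> f z = F (z ^ d)"
    and G_hol: "G holomorphic_on S" and G_inj: "inj_on G S"
    and F_G: "\<And>w. w \<in> S \<Longrightarrow> F (G w) = w" and G_1 [simp]: "G 1 = 0"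
  using fixed_point unfolding period_doubling_fixed_point_def by auto

lemma d_pos: "0 < d" using d2 by simp

lemma lam2: "lam\<^sup>2 < 1" using lam by (simp add: power_less_one_iff)
lemma inv_lam: "1 < 1 / lam" "1 < 1 / lam\<^sup>2" "1 / lam < 1 / lam\<^sup>2"
proof -
  show "1 < 1 / lam" "1 < 1 / lam\<^sup>2" using lam lam2 by (auto simp: field_simps)
  show "1 / lam < 1 / lam\<^sup>2" using lam by (auto simp: field_simps power2_eq_square)
qed

lemma of_real_mem_S [simp]: "complex_of_real x \<in> S \<longleftrightarrow> x \<in> I"
  by (auto simp: mem_slit_plane)

lemma unit_interval_I: "{-1..1} \<subseteq> I" using inv_lam by auto

lemma open_S: "open S"
proof -
  have "S = {z. Im z < 0} \<union> {z. Im z > 0} \<union> ({z. Re z > - 1 / lam} \<inter> {z. Re z < 1 / lam\<^sup>2})"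
    by (auto simp: mem_slit_plane)
  then show ?thesis
    by (auto intro!: open_Un open_Int open_halfspace_Im_lt open_halfspace_Im_gt
        open_halfspace_Re_lt open_halfspace_Re_gt)
qed

lemma starlike_0: "starlike D"
  if "0 \<in> D" "\<And>w t. w \<in> D \<Longrightarrow> 0 < t \<Longrightarrow> t < 1 \<Longrightarrow> complex_of_real t * w \<in> D" for D
  unfolding starlike_def
proof (intro bexI ballI subsetI)
  fix w z assume w: "w \<in> D" "z \<in> closed_segment 0 w"
  then obtain t where "0 \<le> t" "t \<le> 1" "z = of_real t * w"
    by (auto simp: closed_segment_def scaleR_conv_of_real)
  then show "z \<in> D" using that w by (cases "t = 0"; cases "t = 1") auto
qed (rule that(1))

lemma scale_I: "t * x \<in> I" if "x \<in> I" "0 < t" "t < 1"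
proof -
  have "min x 0 \<le> t * x" "t * x \<le> max x 0" using that
    by (auto simp: min_def max_def mult_le_cancel_right1 mult_le_cancel_right2 mult_le_0_iff zero_le_mult_iff)
  moreover have "min x 0 > - 1 / lam" "max x 0 < 1 / lam\<^sup>2" using that inv_lam lam by auto
  ultimately show ?thesis unfolding greaterThanLessThan_iff by linarith
qed

lemma starlike_S: "starlike S"
proof (rule starlike_0)
  show "0 \<in> S" using of_real_mem_S[of 0] lam by auto
  fix w t assume "w \<in> S" "0 < t" "t < (1::real)"
  then show "complex_of_real t * w \<in> S"
    using scale_I[of "Re w" t] by (auto simp: mem_slit_plane)
qed

lemma connected_S: "connected S" using starlike_S starlike_imp_connected by blast

lemma open_GS: "open (G ` S)"
  using open_mapping_thm3[OF G_hol open_S G_inj] .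

lemma mem_W: "z \<in> W \<longleftrightarrow> (\<exists>w\<in>S. z ^ d = G w)"
  by (auto simp: pl_domain_def)

lemma f_W': "f z = w" if "z ^ d = G w" "w \<in> S"
  using that f_W[of z] F_G mem_W by force

lemma f_in_S: "f z \<in> S" "G (f z) = z ^ d" if "z \<in> W"
  using that f_W' unfolding mem_W by auto

lemma even_W: "- z \<in> W \<longleftrightarrow> z \<in> W" "z \<in> W \<Longrightarrow> f (- z) = f z"
proof -
  show *: "- z \<in> W \<longleftrightarrow> z \<in> W" using even_d by (simp add: mem_W)
  show "z \<in> W \<Longrightarrow> f (- z) = f z" using f_W * even_d by simp
qed

lemma open_W: "open W"
proof -
  have "W = (\<lambda>z. z ^ d) -` (G ` S)" by (auto simp: pl_domain_def)
  then show ?thesis using open_vimage[OF open_GS continuous_on_power[OF continuous_on_id]] by simp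
qed

text \<open>On \<open>W\<close>, \<open>f\<close> is the holomorphic inverse of the univalent
  \<open>G\<close> composed with \<open>z ^ d\<close>; \<open>F\<close> itself is only known as a
  left inverse of \<open>G\<close>.\<close>

lemma f_hol: "f holomorphic_on W"
proof -
  obtain h where h: "h holomorphic_on (G ` S)" "\<And>z. z \<in> S \<Longrightarrow> h (G z) = z"
    using holomorphic_has_inverse[OF G_hol open_S G_inj] by metis
  have "(h \<circ> (\<lambda>z. z ^ d)) holomorphic_on W"
    by (rule holomorphic_on_compose_gen[OF _ h(1)]) (auto simp: pl_domain_def intro!: holomorphic_intros)
  then show ?thesis
    by (rule holomorphic_transform) (use f_W' h mem_W in auto)
qed

lemma one_in_S: "1 \<in> S" using of_real_mem_S[of 1] inv_lam lam by auto
lemma zero_in_W: "0 \<in> W" using d_pos one_in_S by (auto simp: mem_W intro!: bexI[of _ 1])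

section \<open>The map \<open>G\<close> near \<open>[-1, 1]\<close> and on the real axis\<close>

text \<open>Near \<open>0\<close> the relation comes from \<open>W\<close>. The identity theorem
  carries it over a connected neighbourhood of the segment on which \<open>f\<close> takes values in
  \<open>S\<close>; in particular the segment lies in \<open>W\<close>.\<close>

lemma G_f_segment:
  obtains N where "open N" "complex_of_real ` {-1..1} \<subseteq> N" "f holomorphic_on N" "f ` N \<subseteq> S"
    "\<And>z. z \<in> N \<Longrightarrow> G (f z) = z ^ d"
proof -
  let ?E = "complex_of_real ` {-1..1}"
  obtain T where T: "open T" "?E \<subseteq> T" "f holomorphic_on T"
    using f_analytic analytic_on_holomorphic by blast
  define U where "U = T \<inter> f -` S"
  have U: "open U" unfolding U_def
    using T open_S by (intro continuous_open_preimage holomorphic_on_imp_continuous_on)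
  have EU: "?E \<subseteq> U"
    using T f_real unit_interval_I unfolding U_def by fastforce
  define N where "N = connected_component_set U 0"
  have E: "connected ?E" by (intro connected_continuous_image continuous_intros) auto
  have N: "open N" "connected N" "N \<subseteq> U"
    using U by (auto simp: N_def open_connected_component connected_component_subset)
  have EN: "?E \<subseteq> N" unfolding N_def
    by (rule connected_component_maximal) (use E EU in \<open>auto intro!: image_eqI[of _ _ 0]\<close>)
  have fN: "f holomorphic_on N" "f ` N \<subseteq> S" using T N holomorphic_on_subset by (auto simp: U_def)
  have "0 \<in> N" using EN by force
  have "G (f z) = z ^ d" if "z \<in> N" for z
  proof (rule analytic_continuation_open[of "N \<inter> W" N "G \<circ> f" "\<lambda>z. z ^ d", unfolded o_def])
    show "(\<lambda>x. G (f x)) holomorphic_on N"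
      using holomorphic_on_compose_gen[OF fN(1) G_hol fN(2)] by (simp add: o_def)
  qed (use N open_W zero_in_W \<open>0 \<in> N\<close> f_in_S that in \<open>auto intro!: holomorphic_intros\<close>)
  then show ?thesis using that N EN fN by blast
qed

text \<open>\<open>f\<close> runs continuously from \<open>f 0 = 1\<close> to
  \<open>f 1 = - L\<close>, so every \<open>x\<close> in between is a value \<open>f y\<close>, and
  then \<open>G x = y ^ d\<close>.\<close>

lemma G_on_real_segment:
  assumes "x \<in> {- lam..1}"
  shows "\<exists>y\<in>{0..1}. G (of_real x) = of_real (y ^ d)"
proof -
  obtain N where N: "open N" "complex_of_real ` {-1..1} \<subseteq> N" "f holomorphic_on N" "f ` N \<subseteq> S"
    "\<And>z. z \<in> N \<Longrightarrow> G (f z) = z ^ d" using G_f_segment by blast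
  have "continuous_on {0..1} (\<lambda>y. Re (f (of_real y)))"
    by (intro continuous_intros continuous_on_compose2[OF holomorphic_on_imp_continuous_on[OF N(3)]])
      (use N(2) in auto)
  then have "\<exists>y\<ge>0. y \<le> 1 \<and> Re (f (of_real y)) = x"
    using assms by (intro IVT2') (auto simp: f_1)
  then obtain y where y: "0 \<le> y" "y \<le> 1" "Re (f (of_real y)) = x" by auto
  have "f (of_real y) \<in> complex_of_real ` {-1..1}" using f_real y by auto
  then have "f (of_real y) = of_real x" using y by auto
  then have "G (of_real x) = of_real (y ^ d)" using N(2) N(5)[of "of_real y"] y
    by (metis atLeastAtMost_iff image_eqI of_real_power order_trans subsetD zero_le_one neg_le_0_iff_le)
  then show ?thesis using y by auto
qed

lemma G_minus_lam: "G (- L) = 1"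
proof -
  obtain N where "complex_of_real ` {-1..1} \<subseteq> N" "\<And>z. z \<in> N \<Longrightarrow> G (f z) = z ^ d"
    using G_f_segment by metis
  then have "G (f (of_real 1)) = of_real 1 ^ d" by (meson atLeastAtMost_iff image_eqI order_refl subsetD zero_le_one neg_le_0_iff_le order_trans)
  then show ?thesis by (simp add: f_1)
qed

lemma cnj_S: "cnj z \<in> S \<longleftrightarrow> z \<in> S" by (auto simp: mem_slit_plane)

text \<open>Schwarz reflection: \<open>G\<close> is real on \<open>[-lam, 1]\<close>, so it agrees
  there, and hence on all of \<open>S\<close>, with its conjugate.\<close>

lemma G_cnj:
  assumes "z \<in> S"
  shows "G (cnj z) = cnj (G z)"
proof -
  let ?U = "complex_of_real ` {- lam..1}"
  have US: "?U \<subseteq> S"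
  proof
    fix z assume "z \<in> ?U"
    then obtain x where "z = of_real x" "x \<in> {-1..1}" using lam by auto
    then show "z \<in> S" using unit_interval_I by auto
  qed
  have cS: "cnj ` S = S" 
    by (auto simp: cnj_S intro!: image_eqI[of _ cnj "cnj _"])
  have "G z - (cnj \<circ> G \<circ> cnj) z = 0"
  proof (rule analytic_continuation[of "\<lambda>z. G z - (cnj \<circ> G \<circ> cnj) z" S ?U 1])
    have "(cnj \<circ> G \<circ> cnj) holomorphic_on S"
      using holomorphic_on_compose_cnj_cnj[of G S] cS open_S G_hol by simp
    then show "(\<lambda>z. G z - (cnj \<circ> G \<circ> cnj) z) holomorphic_on S"
      using G_hol by (intro holomorphic_intros)
    show "1 islimpt ?U"
    proof (rule connected_imp_perfect)
      show "connected ?U" by (intro connected_continuous_image continuous_intros) auto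
      show "1 \<in> ?U" using lam by (auto intro!: image_eqI[of _ _ 1])
      have "of_real 0 \<in> ?U" "of_real 1 \<in> ?U" using lam by (intro imageI; simp)+
      then show "?U \<noteq> {x}" for x by (metis of_real_0 of_real_1 singletonD zero_neq_one)
    qed
    fix z assume "z \<in> ?U"
    then obtain x where x: "z = of_real x" "x \<in> {- lam..1}" by auto
    then obtain y where "G z = of_real y" using G_on_real_segment by blast
    then show "G z - (cnj \<circ> G \<circ> cnj) z = 0" using x by simp
  qed (use open_S connected_S US one_in_S assms in auto)
  then show ?thesis by (auto simp: complex_eq_iff)
qed

lemma real_of_G_real:
  assumes "w \<in> S" "Im (G w) = 0"
  shows "Im w = 0"
proof -
  have "G (cnj w) = G w" using G_cnj[OF assms(1)] assms(2) by (simp add: complex_eq_iff)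
  then have "cnj w = w" using G_inj assms(1) cnj_S inj_onD by metis
  then show ?thesis by (simp add: complex_eq_iff)
qed

definition g :: "real \<Rightarrow> real" where "g x = Re (G (of_real x))"

lemma G_of_real: "G (of_real x) = of_real (g x)" if "x \<in> I"
  using G_cnj[of "of_real x"] that of_real_mem_S[of x] by (simp add: g_def complex_eq_iff)

lemma g_1 [simp]: "g 1 = 0" and g_minus_lam [simp]: "g (- lam) = 1"
  using G_minus_lam by (auto simp: g_def)

lemma minus_lam_I: "- lam \<in> I" "0 \<in> I" "1 \<in> I" proof -
  have "- 1 / lam < - 1" using inv_lam(1) by simp
  then show "- lam \<in> I" "0 \<in> I" "1 \<in> I"
    unfolding greaterThanLessThan_iff using inv_lam(2) lam by linarith+
qed

lemma g_cont: "continuous_on I g"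
  unfolding g_def
  by (intro continuous_intros continuous_on_compose2[OF holomorphic_on_imp_continuous_on[OF G_hol]])
    (use of_real_mem_S in auto)

text \<open>A continuous injective function on an interval is strictly monotone, and
  \<open>g (- lam) = 1 > 0 = g 1\<close> fixes the direction.\<close>

lemma g_less_iff: "g x < g y \<longleftrightarrow> y < x" if "x \<in> I" "y \<in> I"
proof -
  have "inj_on g I"
  proof (rule inj_onI)
    fix x y assume "x \<in> I" "y \<in> I" "g x = g y"
    then have "G (of_real x) = G (of_real y)" using G_of_real by simp
    then have "complex_of_real x = of_real y"
      using G_inj \<open>x \<in> I\<close> \<open>y \<in> I\<close> of_real_mem_S inj_onD by metis
    then show "x = y" by simp
  qed
  then have "strict_mono_on I g \<or> strict_antimono_on I g"
    using injective_eq_monotone_map[of I g] g_cont is_interval_oo by blast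
  moreover have "\<not> strict_mono_on I g"
    using minus_lam_I lam strict_mono_onD[of I g "- lam" 1] by auto
  ultimately have *: "\<And>x y. x \<in> I \<Longrightarrow> y \<in> I \<Longrightarrow> x < y \<Longrightarrow> g y < g x"
    by (auto simp: monotone_on_def)
  show ?thesis using *[of x y] *[of y x] that by (metis less_asym linorder_neqE_linordered_idom less_irrefl)
qed

section \<open>The holomorphic root \<open>H\<close> and its real trace \<open>h\<close>\<close>

text \<open>\<open>1\<close> is the only zero of \<open>G\<close>, and \<open>- L * w = 1\<close>
  would put \<open>w\<close> at the tip \<open>- 1 / lam\<close> of the left slit.\<close>

lemma minus_lam_scale:
  assumes "w \<in> S"
  shows "- L * w \<in> S" "G (- L * w) \<noteq> 0"
proof -
  have real: "- lam * x \<in> I \<and> - lam * x < 1" if "x \<in> I" for x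
  proof -
    have "lam * x < lam * (1 / lam\<^sup>2)" "lam * (- 1 / lam) < lam * x"
      using that lam by (intro mult_strict_left_mono; simp)+
    then have "lam * x < 1 / lam" "- 1 < lam * x" using lam by (auto simp: power2_eq_square)
    then show ?thesis using inv_lam(2) by auto
  qed
  show *: "- L * w \<in> S"
    using assms real[of "Re w"] lam by (auto simp: mem_slit_plane)
  show "G (- L * w) \<noteq> 0"
  proof
    assume "G (- L * w) = 0"
    then have eq: "- L * w = 1" using * one_in_S G_inj by (metis G_1 inj_onD)
    then have "Im w = 0" "- lam * Re w = 1" using lam by (auto simp: complex_eq_iff)
    then show False using assms real[of "Re w"] by (auto simp: mem_slit_plane)
  qed
qed

text \<open>A zero-free holomorphic function on the starlike \<open>S\<close> has a logarithm;
  subtracting \<open>l 1\<close> normalizes the root, since \<open>G (- L) = 1\<close>.\<close>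

lemma root_exists:
  "\<exists>H. H holomorphic_on S \<and> (\<forall>w\<in>S. H w ^ d = G (- L * w)) \<and> H 1 = 1"
proof -
  have "(\<lambda>w. G (- L * w)) holomorphic_on S"
    by (rule holomorphic_on_compose_gen[OF _ G_hol, unfolded o_def])
      (use minus_lam_scale in \<open>auto intro!: holomorphic_intros\<close>)
  then obtain l where l: "l holomorphic_on S" "\<And>w. w \<in> S \<Longrightarrow> G (- L * w) = exp (l w)"
    by (rule contractible_imp_holomorphic_log[OF _ starlike_imp_contractible[OF starlike_S]])
      (use minus_lam_scale(2) in auto)
  let ?H = "\<lambda>w. exp ((l w - l 1) / of_nat d)"
  have "?H w ^ d = G (- L * w)" if "w \<in> S" for w
  proof -
    have "?H w ^ d = exp (l w - l 1)" using d_pos by (simp flip: exp_of_nat_mult)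
    also have "\<dots> = G (- L * w)" using l(2)[of 1] l(2)[OF that] one_in_S G_minus_lam
      by (simp add: exp_diff)
    finally show ?thesis .
  qed
  moreover have "?H holomorphic_on S" using l d_pos by (intro holomorphic_intros) auto
  ultimately show ?thesis by (intro exI[of _ ?H]) auto
qed

text \<open>
  \<open>H\<close> is the semiconjugacy \<open>f (\<lambda> z) = H (f z)\<close>, written in the target coordinate of \<open>f\<close>.
\<close>
definition H :: "complex \<Rightarrow> complex" where
  "H = (SOME H. H holomorphic_on S \<and> (\<forall>w\<in>S. H w ^ d = G (- L * w)) \<and> H 1 = 1)"

lemma H_hol: "H holomorphic_on S" and H_power: "w \<in> S \<Longrightarrow> H w ^ d = G (- L * w)"
  and H_1 [simp]: "H 1 = 1"
  using someI_ex[OF root_exists] unfolding H_def by auto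

lemma minus_lam_scale_I: "- lam * x \<in> I" if "x \<in> I"
  using minus_lam_scale(1)[of "of_real x"] that of_real_mem_S[of "- lam * x"] by simp

text \<open>This is \<open>H\<close> on the real interval, as \<open>H_of_real\<close> shows; as a
  real root it inherits its monotonicity from \<open>g\<close>.\<close>

definition h :: "real \<Rightarrow> real" where "h x = root d (g (- lam * x))"

lemma g_pos: "0 < g (- lam * x)" if "x \<in> I"
proof -
  have "- lam * x < 1" 
  proof -
    have "lam * (- 1 / lam) < lam * x" using that lam by (intro mult_strict_left_mono) auto
    then show ?thesis using lam by simp
  qed
  then show ?thesis
    using g_less_iff[of 1 "- lam * x"] minus_lam_scale_I[OF that] minus_lam_I by simp
qed

lemma h_pos: "0 < h x" if "x \<in> I"
  using g_pos[OF that] d_pos by (simp add: h_def)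

lemma h_power: "h x ^ d = g (- lam * x)" if "x \<in> I"
  using g_pos[OF that] d_pos by (simp add: h_def)

lemma h_1 [simp]: "h 1 = 1" using d_pos by (simp add: h_def)

lemma h_less_iff: "h x < h y \<longleftrightarrow> x < y" if "x \<in> I" "y \<in> I"
  using that d_pos lam g_less_iff[of "- lam * x" "- lam * y"] minus_lam_scale_I
  by (simp add: h_def)

lemma h_cont: "continuous_on I h"
  unfolding h_def
  by (intro continuous_intros continuous_on_compose2[OF g_cont] image_subsetI minus_lam_scale_I)

text \<open>The quotient \<open>H / h\<close> is continuous on an interval with values among the
  \<open>d\<close>-th roots of unity, hence constant, and it is \<open>1\<close> at
  \<open>1\<close>.\<close>

lemma H_of_real: "H (of_real x) = of_real (h x)" if "x \<in> I"
proof -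
  let ?c = "\<lambda>x. H (of_real x) / of_real (h x)"
  have "?c constant_on I"
  proof (rule continuous_finite_range_constant)
    show "connected I" by simp
    show "continuous_on I ?c"
      using h_pos of_real_mem_S
      by (intro continuous_intros h_cont continuous_on_compose2[OF holomorphic_on_imp_continuous_on[OF H_hol]])
        force+
    have "?c x ^ d = 1" if "x \<in> I" for x
    proof -
      have "H (of_real x) ^ d = of_real (g (- lam * x))"
        using H_power[of "of_real x"] G_of_real[OF minus_lam_scale_I[OF that]] that of_real_mem_S[of x] by simp
      also have "\<dots> = of_real (h x) ^ d" using h_power[OF that] by (simp flip: of_real_power)
      finally show ?thesis using h_pos[OF that] by (simp add: power_divide)
    qed
    then have "?c ` I \<subseteq> {z. z ^ d = 1}" by blast
    moreover have "finite {z::complex. z ^ d = 1}" using finite_roots_unity[of d] d2 by simp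
    ultimately show "finite (?c ` I)" by (rule finite_subset)
  qed
  then obtain c where c: "\<And>y. y \<in> I \<Longrightarrow> ?c y = c" unfolding constant_on_def by blast
  have "?c x = ?c 1" using c[OF that] c[OF minus_lam_I(3)] by (rule trans[OF _ sym])
  then show ?thesis using h_pos[OF that] by (simp add: divide_eq_eq)
qed

section \<open>The fixed point equation on the whole slit plane\<close>

text \<open>For small \<open>z\<close> both \<open>H (f z)\<close> and \<open>f (L * z)\<close> are
  \<open>d\<close>-th roots of \<open>G (- L * f z)\<close> close to \<open>1\<close>, so they
  agree, and applying \<open>G\<close> gives \<open>L ^ d * z ^ d = L ^ d * G (f z)\<close>. Since
  \<open>f\<close> is open near \<open>0\<close>, the points \<open>w = f z\<close> fill a
  neighbourhood of \<open>1\<close>.\<close>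

lemma local_equation:
  obtains N where "open N" "1 \<in> N" "\<And>w. w \<in> N \<Longrightarrow> w \<in> S \<and> H w \<in> S \<and> G (H w) = L ^ d * G w"
proof -
  obtain N where N: "open N" "complex_of_real ` {-1..1} \<subseteq> N" "f holomorphic_on N" "f ` N \<subseteq> S"
    "\<And>z. z \<in> N \<Longrightarrow> G (f z) = z ^ d" using G_f_segment by blast
  have N01: "0 \<in> N" "1 \<in> N"
  proof -
    have "complex_of_real 0 \<in> N" "complex_of_real 1 \<in> N"
      by (intro subsetD[OF N(2)] imageI; simp)+
    then show "0 \<in> N" "1 \<in> N" by simp_all
  qed
  have evN: "eventually (\<lambda>z. q z \<in> N) (nhds 0)" if "(q \<longlongrightarrow> l) (nhds 0)" "l \<in> N"
    for q :: "complex \<Rightarrow> complex" and l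
    using topological_tendstoD[OF that(1) N(1) that(2)] .
  have isf: "isCont f 0" using N N01 continuous_on_eq_continuous_at holomorphic_on_imp_continuous_on by blast
  have isH: "isCont H 1" using H_hol one_in_S open_S continuous_on_eq_continuous_at holomorphic_on_imp_continuous_on by blast
  have Lz: "((\<lambda>z. L * z) \<longlongrightarrow> 0) (nhds 0)"
    by (auto intro!: tendsto_eq_intros filterlim_ident)
  have fz: "(f \<longlongrightarrow> 1) (nhds 0)" using isf unfolding isCont_def tendsto_at_iff_tendsto_nhds by simp
  then have fLz: "((\<lambda>z. f (L * z)) \<longlongrightarrow> 1) (nhds 0)" using filterlim_compose[OF _ Lz] by blast
  have Hfz: "((\<lambda>z. H (f z)) \<longlongrightarrow> 1) (nhds 0)"
    using isH filterlim_compose[OF _ fz, of H "nhds 1"]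
    unfolding isCont_def tendsto_at_iff_tendsto_nhds by simp
  have "eventually (\<lambda>z. z \<in> N) (nhds 0)" using N N01 eventually_nhds_in_open by blast
  moreover note evN[OF Lz N01(1)] evN[OF fLz N01(2)] f_equation
  ultimately have A: "eventually (\<lambda>z. z \<in> N \<and> L * z \<in> N \<and> H (f z) ^ d = f (L * z) ^ d) (nhds 0)"
  proof eventually_elim
    case (elim z)
    then have "f (f (L * z)) = - L * f z" using lam by (simp add: field_simps)
    then show ?case using elim N(4) N(5)[of "f (L * z)"] H_power[of "f z"] by auto
  qed
  moreover have "eventually (\<lambda>z. H (f z) = f (L * z)) (nhds 0)"
    by (rule eventually_eq_of_power_eq[OF Hfz fLz d_pos]) (use A in eventually_elim, simp)
  ultimately have "eventually (\<lambda>z. z \<in> N \<and> f z \<in> S \<and> H (f z) \<in> S \<and> G (H (f z)) = L ^ d * G (f z)) (nhds 0)"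
    by eventually_elim (use N(4,5) in \<open>auto simp: power_mult_distrib\<close>)
  then obtain e where e: "0 < e"
    "\<And>z. z \<in> ball 0 e \<Longrightarrow> z \<in> N \<and> f z \<in> S \<and> H (f z) \<in> S \<and> G (H (f z)) = L ^ d * G (f z)"
    by (auto simp: eventually_nhds_metric dist_commute)
  have "\<not> f constant_on ball 0 e"
  proof
    assume "f constant_on ball 0 e"
    moreover have z: "complex_of_real (e / 2) \<in> ball 0 e" "0 \<in> ball (0::complex) e" using e by auto
    ultimately have "f (complex_of_real (e / 2)) = f 0" unfolding constant_on_def by metis
    then have "complex_of_real (e / 2) ^ d = 0" using N(5)[of "complex_of_real (e / 2)"] e(2)[OF z(1)] by simp
    then show False using e(1) by simp
  qed
  then have "open (f ` ball 0 e)"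
    using e(2) N(3) holomorphic_on_subset[of f N "ball 0 e"]
    by (intro open_mapping_thm[of f "ball 0 e"]) auto
  moreover have "1 \<in> f ` ball 0 e" using e(1) by (intro image_eqI[of _ _ 0]) auto
  ultimately show ?thesis using that e(2) by blast
qed

text \<open>Both slits are real, so \<open>H w ^ d = G (- L * w)\<close> is real, which forces
  \<open>w\<close> to be real. Then \<open>H w = h (Re w) > 0\<close> leaves only the right
  slit.\<close>

lemma H_not_in_S:
  assumes "w \<in> S" "H w \<notin> S"
  shows "Im w = 0" "1 / lam\<^sup>2 \<le> h (Re w)"
proof -
  have "Im (H w) = 0" using assms(2) by (simp add: mem_slit_plane)
  then have "H w = of_real (Re (H w))" by (simp add: complex_eq_iff)
  then have "Im (H w ^ d) = 0" by (metis Im_complex_of_real of_real_power)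
  then show *: "Im w = 0"
    using real_of_G_real[OF minus_lam_scale(1)[OF assms(1)]] H_power[OF assms(1)] lam by simp
  then have w: "w = of_real (Re w)" "Re w \<in> I" using assms(1) by (auto simp: complex_eq_iff mem_slit_plane)
  then have "h (Re w) \<notin> I" using assms(2) H_of_real of_real_mem_S by metis
  moreover have "- 1 / lam < h (Re w)"
    using h_pos[OF w(2)] less_trans[of "- 1 / lam" 0 "h (Re w)"] lam by simp
  ultimately show "1 / lam\<^sup>2 \<le> h (Re w)" by simp
qed

text \<open>The set \<open>D\<close> where both sides make sense is starlike about \<open>0\<close>:
  by \<open>H_not_in_S\<close> a ray can leave it only on the real axis, with \<open>h\<close> at
  least \<open>1 / lam\<^sup>2\<close>, and the increasing \<open>h\<close> cannot come back. The
  identity theorem then spreads \<open>local_equation\<close> over \<open>D\<close>.\<close>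

lemma equation_where_defined:
  assumes "w \<in> S" "H w \<in> S"
  shows "G (H w) = L ^ d * G w"
proof -
  define D where "D = S \<inter> H -` S"
  have D: "open D" unfolding D_def
    using open_S H_hol by (intro continuous_open_preimage holomorphic_on_imp_continuous_on)
  have "starlike D"
  proof (rule starlike_0)
    have h0: "h 0 < 1" using h_less_iff[of 0 1] minus_lam_I by simp
    then have "H 0 \<in> S"
      using H_not_in_S(2)[of 0] inv_lam(2) of_real_mem_S[of 0] minus_lam_I by fastforce
    then show "0 \<in> D" using of_real_mem_S[of 0] minus_lam_I by (simp add: D_def)
    fix w t assume w: "w \<in> D" and t: "0 < t" "t < (1::real)"
    have tw: "complex_of_real t * w \<in> S"
      using scale_I[of "Re w" t] w t by (auto simp: mem_slit_plane D_def)
    moreover have "H (complex_of_real t * w) \<in> S"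
    proof (rule ccontr)
      assume n: "H (complex_of_real t * w) \<notin> S"
      have wr: "Im w = 0" using H_not_in_S(1)[OF tw n] t by simp
      then have w': "w = of_real (Re w)" "Re w \<in> I" using w by (auto simp: complex_eq_iff mem_slit_plane D_def)
      have ht: "1 / lam\<^sup>2 \<le> h (t * Re w)" using H_not_in_S(2)[OF tw n] by simp
      have tI: "t * Re w \<in> I" using scale_I[OF w'(2) t] .
      have "0 < t * Re w"
        using h_less_iff[of 0 "t * Re w"] tI minus_lam_I h0 ht inv_lam(2) by simp
      then have "t * Re w < Re w" using t by (simp add: zero_less_mult_iff)
      then have "1 / lam\<^sup>2 \<le> h (Re w)" using h_less_iff[OF tI w'(2)] ht by simp
      then have "h (Re w) \<notin> I" by simp
      moreover have "H w = of_real (h (Re w))" using H_of_real w' by metis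
      ultimately show False using w of_real_mem_S by (simp add: D_def)
    qed
    ultimately show "complex_of_real t * w \<in> D" by (simp add: D_def)
  qed
  then have conn: "connected D" using starlike_imp_connected by blast
  obtain N where N: "open N" "1 \<in> N" "\<And>w. w \<in> N \<Longrightarrow> w \<in> S \<and> H w \<in> S \<and> G (H w) = L ^ d * G w"
    using local_equation by metis
  show ?thesis
  proof (rule analytic_continuation_open[of N D "\<lambda>w. G (H w)" "\<lambda>w. L ^ d * G w"])
    show "(\<lambda>w. G (H w)) holomorphic_on D"
      by (rule holomorphic_on_compose_gen[OF _ G_hol, unfolded o_def])
        (use H_hol holomorphic_on_subset in \<open>auto simp: D_def\<close>)
    show "(\<lambda>w. L ^ d * G w) holomorphic_on D"
      using G_hol holomorphic_on_subset by (intro holomorphic_intros) (auto simp: D_def)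
  qed (use N D conn assms in \<open>auto simp: D_def\<close>)
qed

lemma g_h: "g (h x) = lam ^ d * g x" if "x \<in> I" "h x \<in> I"
proof -
  have "G (H (of_real x)) = L ^ d * G (of_real x)"
    by (rule equation_where_defined) (use that H_of_real of_real_mem_S in auto)
  then have "complex_of_real (g (h x)) = of_real (lam ^ d * g x)"
    using that by (simp add: H_of_real G_of_real)
  then show ?thesis using of_real_eq_iff by blast
qed

text \<open>
  On \<open>(1, 1 / \<lambda>\<^sup>2)\<close> the function \<open>g\<close> is negative and decreasing, so \<open>g (h x) = \<lambda>^d g x > g x\<close> forces
  \<open>h x < x\<close>; hence \<open>h\<close> cannot reach the right slit.
\<close>
lemma H_in_S:
  assumes "w \<in> S"
  shows "H w \<in> S"
proof (rule ccontr)
  assume n: "H w \<notin> S"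
  define x where "x = Re w"
  have x: "x \<in> I" "1 / lam\<^sup>2 \<le> h x"
    using H_not_in_S[OF assms n] assms by (auto simp: x_def mem_slit_plane)
  have x1: "1 < x" using h_less_iff[of 1 x] x minus_lam_I inv_lam(2) by simp
  have sub: "{1..x} \<subseteq> I" using x(1) minus_lam_I by auto
  have "\<exists>y\<ge>1. y \<le> x \<and> h y = x"
    using x x1 sub by (intro IVT' continuous_on_subset[OF h_cont]) auto
  then obtain y where y: "1 \<le> y" "y \<le> x" "h y = x" by auto
  have "y \<noteq> 1" "y \<noteq> x" using y x x1 by auto
  then have y': "1 < y" "y < x" "y \<in> I" using y sub by auto
  have "g y < 0" using g_less_iff[of y 1] y' minus_lam_I by simp
  moreover have "g x = lam ^ d * g y" using g_h[of y] y' y x by simp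
  moreover have "lam ^ d < 1" using lam d_pos by (simp add: power_less_one_iff)
  ultimately have "g y < g x" by (simp add: mult_less_cancel_right2)
  then show False using g_less_iff[OF y'(3) x(1)] y' by simp
qed

lemma equation: "w \<in> S \<Longrightarrow> G (H w) = L ^ d * G w"
  using equation_where_defined H_in_S by blast

section \<open>Scaling invariance of \<open>W\<close>\<close>

text \<open>With \<open>w = f z\<close>, \<open>equation\<close> reads
  \<open>(L * z) ^ d = G (H w)\<close>, so \<open>f (L * z) = H w\<close>; and
  \<open>H w ^ d = G (- L * w)\<close> gives \<open>f (H w) = - L * w\<close>.\<close>

lemma scale_W:
  assumes "z \<in> W"
  shows "L * z \<in> W" "f (L * z) \<in> W" "f (f (L * z)) = - L * f z"
proof -
  have w: "f z \<in> S" "G (f z) = z ^ d" using f_in_S[OF assms] by auto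
  have e: "(L * z) ^ d = G (H (f z))" using w equation by (simp add: power_mult_distrib)
  then show "L * z \<in> W" using mem_W H_in_S w by blast
  have f: "f (L * z) = H (f z)" using f_W'[OF e] H_in_S w by blast
  have "H (f z) ^ d = G (- L * f z)" using H_power w by blast
  then show "f (L * z) \<in> W" "f (f (L * z)) = - L * f z"
    using f f_W' minus_lam_scale(1) mem_W w by metis+
qed

text \<open>A point of \<open>W\<close> on a slit would be a real \<open>x\<close> of modulus at
  least \<open>1 / lam\<close> with \<open>x ^ d = g v\<close>. Then
  \<open>lam ^ d * g v \<ge> 1\<close>, whereas
  \<open>lam ^ d * g v = g (h v) < g 0 < 1\<close>.\<close>

lemma W_subset_S: "W \<subseteq> S"
proof
  fix z assume "z \<in> W"
  then obtain w where w: "w \<in> S" "z ^ d = G w" by (auto simp: mem_W)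
  show "z \<in> S"
  proof (rule ccontr)
    assume "z \<notin> S"
    then have z: "Im z = 0" "Re z \<le> - 1 / lam \<or> 1 / lam\<^sup>2 \<le> Re z" by (auto simp: mem_slit_plane)
    define x where "x = Re z"
    have zx: "z = of_real x" using z by (simp add: x_def complex_eq_iff)
    have "1 / lam \<le> \<bar>x\<bar>" using z(2) inv_lam by (auto simp: x_def)
    then have "1 \<le> lam * \<bar>x\<bar>" using lam by (simp add: field_simps)
    then have "1 \<le> (lam * \<bar>x\<bar>) ^ d" by simp
    then have big: "1 \<le> lam ^ d * x ^ d" using even_d by (simp add: power_mult_distrib power_even_abs)
    have Gw: "G w = of_real (x ^ d)" using w zx by simp
    then have "Im w = 0" using real_of_G_real[OF w(1)] by simp
    then have "w = of_real (Re w)" "Re w \<in> I" using w(1) by (auto simp: complex_eq_iff mem_slit_plane)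
    then obtain v where v: "w = of_real v" "v \<in> I" by blast
    have gv: "g v = x ^ d" using Gw v by (simp add: g_def)
    have hv: "h v \<in> I" using H_in_S[OF w(1)] v H_of_real of_real_mem_S by metis
    have "lam ^ d * g v = g (h v)" using g_h v hv by simp
    also have "\<dots> < g 0" using g_less_iff[OF hv, of 0] h_pos[OF v(2)] minus_lam_I by simp
    also have "\<dots> < 1" using g_less_iff[of 0 "- lam"] minus_lam_I lam by simp
    finally show False using big gv by simp
  qed
qed

section \<open>Domains of the iterates\<close>

text \<open>Only iterates before the \<open>m\<close>-th are constrained, so
  \<open>V 0 = UNIV\<close> and \<open>V 1 = W\<close>; in order to apply \<open>G\<close>,
  \<open>connected_V\<close> intersects with \<open>S\<close>.\<close>

definition V :: "nat \<Rightarrow> complex set" where "V m = {z. \<forall>k<m. (f ^^ k) z \<in> W}"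

lemma V_0 [simp]: "V 0 = UNIV" by (simp add: V_def)

lemma V_Suc: "z \<in> V (Suc m) \<longleftrightarrow> z \<in> W \<and> f z \<in> V m"
  unfolding V_def by (auto simp: less_Suc_eq_0_disj funpow_swap1)

lemma V_Suc': "z \<in> V (Suc m) \<longleftrightarrow> z \<in> V m \<and> (f ^^ m) z \<in> W"
  unfolding V_def by (auto simp: less_Suc_eq)

lemma V_antimono: "m \<le> n \<Longrightarrow> V n \<subseteq> V m" by (auto simp: V_def)

lemma V_eq_Int: "V (Suc m) = W \<inter> f -` V m"
  by (auto simp: V_Suc)

lemma V_1: "V 1 = W" using V_eq_Int[of 0] by simp

lemma uminus_V: "- z \<in> V m \<longleftrightarrow> z \<in> V m"
  using even_W by (cases m) (auto simp: V_Suc)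

lemma funpow_uminus: "z \<in> W \<Longrightarrow> 0 < m \<Longrightarrow> (f ^^ m) (- z) = (f ^^ m) z"
  using even_W(2) by (cases m) (auto simp: funpow_swap1)

lemma open_V: "open (V m)"
proof (induction m)
  case (Suc m)
  then show ?case unfolding V_eq_Int
    using open_W f_hol by (intro continuous_open_preimage holomorphic_on_imp_continuous_on)
qed simp

lemma funpow_hol: "(f ^^ m) holomorphic_on V m"
proof (induction m)
  case 0
  show ?case by (simp add: id_def)
next
  case (Suc m)
  have "((f ^^ m) \<circ> f) holomorphic_on V (Suc m)"
    by (rule holomorphic_on_compose_gen[OF _ Suc])
      (use f_hol holomorphic_on_subset in \<open>auto simp: V_eq_Int\<close>)
  then show ?case by (simp only: funpow_Suc_right)
qed

text \<open>The segment is invariant under \<open>f\<close> and lies in \<open>W\<close>; in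
  particular the critical value \<open>1\<close> never escapes.\<close>

lemma segment_subset_V: "complex_of_real ` {-1..1} \<subseteq> V m"
proof (induction m)
  case (Suc m)
  obtain N where "complex_of_real ` {-1..1} \<subseteq> N" "f ` N \<subseteq> S" "\<And>z. z \<in> N \<Longrightarrow> G (f z) = z ^ d"
    using G_f_segment by metis
  then have "complex_of_real ` {-1..1} \<subseteq> W" by (force simp: mem_W)
  then show ?case using Suc f_real unfolding V_eq_Int by fast
qed simp

lemma one_in_V: "1 \<in> V m"
proof -
  have "complex_of_real 1 \<in> V m" by (intro subsetD[OF segment_subset_V] imageI) simp
  then show ?thesis by simp
qed

text \<open>\<open>S \<inter> V (Suc m)\<close> is the preimage under \<open>z ^ d\<close> of the
  \<open>G\<close>-image of \<open>S \<inter> V m\<close>, an open connected set that contains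
  \<open>0 = G 1\<close> because the critical value never escapes.\<close>

lemma connected_V: "connected (S \<inter> V m)"
proof (induction m)
  case (Suc m)
  have "open (G ` (S \<inter> V m))"
    using open_S open_V G_hol G_inj
    by (intro open_mapping_thm3) (auto intro: holomorphic_on_subset inj_on_subset)
  moreover have "connected (G ` (S \<inter> V m))"
    using Suc G_hol by (intro connected_continuous_image holomorphic_on_imp_continuous_on)
      (auto intro: holomorphic_on_subset)
  moreover have "0 \<in> G ` (S \<inter> V m)" using one_in_S one_in_V by (intro image_eqI[of _ _ 1]) auto
  ultimately have "connected {z. z ^ d \<in> G ` (S \<inter> V m)}"
    using d_pos by (rule connected_power_preimage)
  moreover have "{z. z ^ d \<in> G ` (S \<inter> V m)} = S \<inter> V (Suc m)"
  proof (intro equalityI subsetI)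
    fix z assume "z \<in> {z. z ^ d \<in> G ` (S \<inter> V m)}"
    then obtain w where w: "w \<in> S" "w \<in> V m" "z ^ d = G w" by auto
    then have "z \<in> W" "f z = w" using mem_W f_W' by auto
    then show "z \<in> S \<inter> V (Suc m)" using w W_subset_S by (auto simp: V_Suc)
  next
    fix z assume "z \<in> S \<inter> V (Suc m)"
    then show "z \<in> {z. z ^ d \<in> G ` (S \<inter> V m)}"
      using f_in_S[of z] by (auto simp: V_Suc intro!: image_eqI[of _ _ "f z"])
  qed
  ultimately show ?case by simp
qed (simp add: connected_S)

text \<open>One step of \<open>f\<close> at \<open>z\<close> matches two steps at
  \<open>L * z\<close>, up to the factor \<open>- L\<close>. The equation is restricted to
  \<open>0 < m\<close> because no sign appears without iteration.\<close>

lemma scale_V: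
  "z \<in> V m \<Longrightarrow> L * z \<in> V (2 * m) \<and> (0 < m \<longrightarrow> (f ^^ (2 * m)) (L * z) = - L * (f ^^ m) z)"
proof (induction m arbitrary: z)
  case (Suc m)
  have z: "z \<in> W" "f z \<in> V m" using Suc.prems by (auto simp: V_Suc)
  note sc = scale_W[OF z(1)]
  have IH: "L * f z \<in> V (2 * m)" "0 < m \<Longrightarrow> (f ^^ (2 * m)) (L * f z) = - L * (f ^^ m) (f z)"
    using Suc.IH[OF z(2)] by auto
  have "(f ^^ (2 * Suc m)) (L * z) = (f ^^ (2 * m)) (f (f (L * z)))"
    by (simp add: funpow_swap1)
  also have "\<dots> = (f ^^ (2 * m)) (- (L * f z))" using sc(3) by simp
  also have "\<dots> = - L * (f ^^ Suc m) z"
  \<comment> \<open>If more steps follow, evenness of \<open>f\<close> removes the sign of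
    \<open>- (L * f z)\<close> and the induction hypothesis brings in a new one; if
    \<open>m = 0\<close>, the sign remains as wanted.\<close>
  proof (cases "m = 0")
    case False
    then obtain m' where m': "m = Suc m'" using not0_implies_Suc by blast
    then have "L * f z \<in> W" using IH(1) by (simp add: V_Suc)
    then show ?thesis using funpow_uminus[of "L * f z" "2 * m"] IH(2) False by (simp add: funpow_swap1)
  qed simp
  finally show ?case using sc IH(1) uminus_V[of "L * f z"] by (simp add: V_Suc)
qed simp

lemma scale_W_power:
  assumes "z \<in> W"
  shows "L ^ n * z \<in> V (2 ^ n) \<and> (f ^^ (2 ^ n)) (L ^ n * z) = (- L) ^ n * f z"
proof (induction n)
  case 0
  show ?case using assms V_1 by simp
next
  case (Suc n)
  then show ?case using scale_V[of "L ^ n * z" "2 ^ n"] by (simp add: mult.assoc)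
qed

text \<open>
  The preimages under \<open>f ^^ m : V m \<rightarrow> S\<close> of compact sets are compact; only the closedness is used.
\<close>
lemma V_closed:
  assumes "\<And>k. z k \<in> V m" "z \<longlonglongrightarrow> q" "(\<lambda>k. (f ^^ m) (z k)) \<longlonglongrightarrow> y" "y \<in> S"
  shows "q \<in> V m"
  using assms
proof (induction m arbitrary: z y)
  case (Suc m)
  define u where "u k = (f ^^ m) (z k)" for k
  have z: "z k \<in> V m" "u k \<in> W" for k using Suc.prems(1) V_Suc' by (auto simp: u_def)
  have fu: "(\<lambda>k. f (u k)) \<longlonglongrightarrow> y" using Suc.prems(3) by (simp add: u_def)
  have "isCont G y"
    using G_hol open_S Suc.prems(4) continuous_on_eq_continuous_at holomorphic_on_imp_continuous_on by blast
  then have "(\<lambda>k. G (f (u k))) \<longlonglongrightarrow> G y" using fu isCont_tendsto_compose by blast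
  then have "(\<lambda>k. u k ^ d) \<longlonglongrightarrow> G y" using f_in_S(2) z(2) by simp
  then obtain v r where v: "strict_mono r" "(u \<circ> r) \<longlonglongrightarrow> v" "v ^ d = G y"
    using power_convergent_subsequence d_pos by blast
  \<comment> \<open>The limit \<open>v\<close> lies in \<open>W\<close>, hence in \<open>S\<close>,
    so the induction hypothesis applies to the subsequence with \<open>v\<close> as the new limit
    value. This is why the last iterate is split off, not the first.\<close>
  have vW: "v \<in> W" using v(3) Suc.prems(4) mem_W by blast
  have zr: "(z \<circ> r) \<longlonglongrightarrow> q" using LIMSEQ_subseq_LIMSEQ[OF Suc.prems(2) v(1)] .
  have q: "q \<in> V m"
    by (rule Suc.IH[of "z \<circ> r" v]) (use z zr v vW W_subset_S in \<open>auto simp: u_def o_def\<close>)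
  have "isCont (f ^^ m) q"
    using funpow_hol open_V q continuous_on_eq_continuous_at holomorphic_on_imp_continuous_on by blast
  then have "(u \<circ> r) \<longlonglongrightarrow> (f ^^ m) q"
    using isCont_tendsto_compose[OF _ zr] by (simp add: u_def o_def)
  then have "(f ^^ m) q = v" using v(2) LIMSEQ_unique by blast
  then show ?case using q vW by (simp add: V_Suc')
qed simp

section \<open>Analytic extensions and the maximal domain\<close>

definition U :: "nat \<Rightarrow> complex set" where "U n = {z. L ^ n * z \<in> V (2 ^ n)}"
definition ext :: "nat \<Rightarrow> complex \<Rightarrow> complex" where
  "ext n z = (f ^^ (2 ^ n)) (L ^ n * z) / (- L) ^ n"

lemma lam_nonzero [simp]: "lam \<noteq> 0" using lam by simp

lemma open_U: "open (U n)"
proof -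
  have "U n = (\<lambda>z. L ^ n * z) -` V (2 ^ n)" by (auto simp: U_def)
  then show ?thesis using open_V by (simp add: open_vimage continuous_on_mult_left)
qed

lemma U_mono: "m \<le> n \<Longrightarrow> U m \<subseteq> U n"
proof (rule lift_Suc_mono_le[of U])
  show "U n \<subseteq> U (Suc n)" for n
  proof
    fix z assume "z \<in> U n"
    then show "z \<in> U (Suc n)" using scale_V[of "L ^ n * z" "2 ^ n"] by (simp add: U_def mult.assoc)
  qed
qed

lemma W_subset_U: "W \<subseteq> U n" using scale_W_power by (auto simp: U_def)

lemma analytic_extension_U: "analytic_extension W f (U n) (ext n)"
  unfolding analytic_extension_def
proof (intro conjI exI[of _ W] ballI)
  \<comment> \<open>As \<open>2 ^ n \<ge> 1\<close>, \<open>V (2 ^ n)\<close> lies in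
    \<open>W\<close> and so in \<open>S\<close>; thus \<open>connected_V\<close> gives connectedness
    of \<open>V (2 ^ n)\<close> itself.\<close>
  have sub: "V (2 ^ n) \<subseteq> S"
    using V_antimono[of 1 "2 ^ n"] V_1 W_subset_S by auto
  have "U n = (\<lambda>z. z / L ^ n) ` V (2 ^ n)"
  proof (intro equalityI subsetI)
    fix z assume "z \<in> U n"
    then show "z \<in> (\<lambda>z. z / L ^ n) ` V (2 ^ n)"
      by (intro image_eqI[of _ _ "L ^ n * z"]) (auto simp: U_def)
  qed (auto simp: U_def)
  moreover have "connected (V (2 ^ n))" using connected_V[of "2 ^ n"] sub by (simp add: Int_absorb1)
  ultimately show "connected (U n)"
    by (auto intro!: connected_continuous_image continuous_intros)
  have "((f ^^ (2 ^ n)) \<circ> (\<lambda>z. L ^ n * z)) holomorphic_on U n"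
    by (rule holomorphic_on_compose_gen[OF _ funpow_hol]) (auto simp: U_def intro!: holomorphic_intros)
  then show "ext n holomorphic_on U n"
    unfolding ext_def o_def by (intro holomorphic_intros) auto
  show "W \<noteq> {}" using zero_in_W by auto
  show "W \<subseteq> U n \<inter> W" using W_subset_U by auto
  show "ext n z = f z" if "z \<in> W" for z using scale_W_power[OF that] by (simp add: ext_def)
qed (use open_U open_W in auto)

lemma unit_ball_subset_S: "norm y < 1 \<Longrightarrow> y \<in> S"
  using abs_Re_le_cmod[of y] inv_lam unfolding mem_slit_plane by (auto simp del: less_divide_eq_1)

text \<open>
  \<open>ext n\<close> maps \<open>U n\<close> properly onto a slit plane containing the disc of radius \<open>\<lambda>^(- n)\<close>, so for large \<open>n\<close>
  no value of \<open>fh\<close> near a boundary point of the union can be omitted.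
\<close>
lemma maximal_domain_eq_Union:
  assumes "maximal_analytic_extension W f Wh fh"
  shows "Wh = (\<Union>n. U n)"
proof -
  have Wh: "open Wh" "connected Wh" "fh holomorphic_on Wh"
    using assms by (auto simp: maximal_analytic_extension_def analytic_extension_def)
  have "U n \<subseteq> Wh \<and> (\<forall>z\<in>U n. ext n z = fh z)" for n
    using assms analytic_extension_U[of n] unfolding maximal_analytic_extension_def by blast
  then have UWh: "\<And>n. U n \<subseteq> Wh" and fhU: "\<And>n z. z \<in> U n \<Longrightarrow> fh z = ext n z"
    by auto
  have "(\<Union>n. U n) = Wh"
  proof (rule GPicard2)
    show "(\<Union>n. U n) \<noteq> {}" using W_subset_U zero_in_W by blast
    fix p assume p: "p islimpt (\<Union>n. U n)" "p \<in> Wh"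
    define M where "M = norm (fh p) + 1"
    have cont: "isCont fh q" if "q \<in> Wh" for q
      using Wh that continuous_on_eq_continuous_at holomorphic_on_imp_continuous_on by blast
    have "eventually (\<lambda>z. norm (fh z) < M) (nhds p)"
      using tendsto_norm[OF cont[OF p(2), unfolded isCont_def tendsto_at_iff_tendsto_nhds]]
      by (intro order_tendstoD(2)[where y = "norm (fh p)"]) (auto simp: M_def)
    moreover have "eventually (\<lambda>z. z \<in> Wh) (nhds p)" using Wh p eventually_nhds_in_open by blast
    ultimately have "eventually (\<lambda>z. z \<in> Wh \<and> norm (fh z) < M) (nhds p)" by eventually_elim simp
    then obtain r where r: "0 < r" "\<And>z. z \<in> ball p r \<Longrightarrow> z \<in> Wh \<and> norm (fh z) < M"
      by (auto simp: eventually_nhds_metric dist_commute)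
    obtain z m where z: "z \<in> ball p r" "z \<in> U m"
      using p(1) r(1) unfolding islimpt_approachable by (auto simp: dist_commute) (metis dist_commute)
    have "(\<lambda>n. lam ^ n * M) \<longlonglongrightarrow> 0 * M"
      using lam by (intro tendsto_mult tendsto_const LIMSEQ_realpow_zero) auto
    then have "eventually (\<lambda>n. lam ^ n * M < 1) sequentially"
      by (rule order_tendstoD(2)) simp
    \<comment> \<open>\<open>m \<le> n\<close> makes \<open>U n\<close> meet the ball, and
      \<open>lam ^ n * M < 1\<close> puts the values of \<open>(- L) ^ n * fh\<close> on the ball
      into the unit disc, hence into \<open>S\<close>. A second clopen argument, with
      \<open>V_closed\<close>, then shows that \<open>U n\<close> contains the ball.\<close>
    then obtain n where n: "m \<le> n" "lam ^ n * M < 1"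
      unfolding eventually_sequentially by (meson nle_le)
    have "ball p r \<inter> U n = ball p r"
    proof (rule GPicard2)
      show "ball p r \<inter> U n \<noteq> {}" using z U_mono[OF n(1)] by blast
      fix q assume q: "q islimpt ball p r \<inter> U n" "q \<in> ball p r"
      then obtain x where x: "\<And>k. x k \<in> U n" "x \<longlonglongrightarrow> q" unfolding islimpt_sequential by blast
      have "(\<lambda>k. fh (x k)) \<longlonglongrightarrow> fh q"
        using isCont_tendsto_compose[OF cont x(2)] q(2) r(2) by blast
      then have "(\<lambda>k. (- L) ^ n * fh (x k)) \<longlonglongrightarrow> (- L) ^ n * fh q" by (intro tendsto_intros)
      moreover have "(- L) ^ n * fh (x k) = (f ^^ (2 ^ n)) (L ^ n * x k)" for k
        using fhU[OF x(1)] by (simp add: ext_def)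
      ultimately have lim: "(\<lambda>k. (f ^^ (2 ^ n)) (L ^ n * x k)) \<longlonglongrightarrow> (- L) ^ n * fh q" by simp
      have "norm ((- L) ^ n * fh q) = lam ^ n * norm (fh q)" using lam by (simp add: norm_mult norm_power)
      also have "\<dots> \<le> lam ^ n * M" using r(2)[OF q(2)] lam by (intro mult_left_mono) auto
      finally have "(- L) ^ n * fh q \<in> S" using n(2) by (intro unit_ball_subset_S) simp
      then have "L ^ n * q \<in> V (2 ^ n)"
        using x by (intro V_closed[OF _ tendsto_mult_left[OF x(2)] lim]) (auto simp: U_def)
      then show "q \<in> ball p r \<inter> U n" using q(2) by (simp add: U_def)
    qed (use open_U in auto)
    then show "p \<in> (\<Union>n. U n)" using r(1) centre_in_ball by blast
  qed (use Wh UWh open_U in auto)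
  then show ?thesis by simp
qed

section \<open>The filled Julia set and the inclusions\<close>

lemma mem_filled_julia: "z \<in> filled_julia W f \<longleftrightarrow> (\<forall>m. z \<in> V m)"
  by (auto simp: filled_julia_def V_def)

text \<open>\<open>scale_V\<close> puts \<open>L * z\<close> into every \<open>V (2 * m)\<close>,
  which is contained in \<open>V m\<close>.\<close>

lemma scale_filled_julia: "z \<in> filled_julia W f \<Longrightarrow> L * z \<in> filled_julia W f"
  using scale_V unfolding mem_filled_julia
  by (metis V_antimono le_add1 mult_2 subsetD)

end

theorem theorem2:
  fixes d :: nat and lam :: real and f F G fh :: "complex \<Rightarrow> complex" and W Wh K :: "complex set"
  assumes "d \<ge> 2" and "even d"
    and "period_doubling_fixed_point d lam f F G"
    and "W = pl_domain d lam G"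
    and "K = filled_julia W f"
    and "maximal_analytic_extension W f Wh fh"
  shows "(\<lambda>z. complex_of_real lam * z) ` K \<subseteq> K
    \<and> K \<subseteq> (\<Union>n::nat. (\<lambda>z. z / complex_of_real lam ^ n) ` K)
    \<and> (\<Union>n::nat. (\<lambda>z. z / complex_of_real lam ^ n) ` K)
        \<subseteq> (\<Inter>n::nat. (\<lambda>z. complex_of_real lam ^ n * z) ` Wh)
    \<and> (\<Inter>n::nat. (\<lambda>z. complex_of_real lam ^ n * z) ` Wh) \<subseteq> Wh
    \<and> Wh \<subseteq> (\<lambda>z. z / complex_of_real lam) ` Wh"
proof -
  interpret period_doubling d lam f F G
    using assms by unfold_locales
  have K: "K = filled_julia (pl_domain d lam G) f" using assms by simp
  have Wh: "Wh = (\<Union>n. U n)" using maximal_domain_eq_Union assms by simp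
  show ?thesis
  proof (intro conjI)
    show "(\<lambda>z. L * z) ` K \<subseteq> K" using scale_filled_julia K by blast
    have "K = (\<lambda>z. z / L ^ 0) ` K" by simp
    then show "K \<subseteq> (\<Union>n::nat. (\<lambda>z. z / L ^ n) ` K)" by blast
    show "(\<Union>n::nat. (\<lambda>z. z / L ^ n) ` K) \<subseteq> (\<Inter>n::nat. (\<lambda>z. L ^ n * z) ` Wh)"
    proof (intro UN_least INT_greatest image_subsetI)
      fix n m :: nat and z assume "z \<in> K"
      \<comment> \<open>Multiplying by \<open>L ^ (n + m)\<close> leads back to \<open>z\<close>,
        which lies in every \<open>V k\<close>, in particular for
        \<open>k = 2 ^ (n + m)\<close>.\<close>
      then have "z / L ^ (n + m) \<in> U (n + m)" using K mem_filled_julia by (simp add: U_def)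
      then have "z / L ^ (n + m) \<in> Wh" unfolding Wh by blast
      then show "z / L ^ n \<in> (\<lambda>z. L ^ m * z) ` Wh"
        by (intro image_eqI[of _ _ "z / L ^ (n + m)"]) (simp_all add: power_add)
    qed
    have "(\<lambda>z. L ^ 0 * z) ` Wh = Wh" by simp
    then show "(\<Inter>n::nat. (\<lambda>z. L ^ n * z) ` Wh) \<subseteq> Wh" by blast
    show "Wh \<subseteq> (\<lambda>z. z / L) ` Wh"
    proof
      fix z assume "z \<in> Wh"
      then obtain n where "z \<in> U n" unfolding Wh by blast
      \<comment> \<open>Moving up one level makes room for the factor:
        \<open>L ^ n * (L * z)\<close> lies in \<open>V (2 ^ Suc n)\<close>, which is contained in
        \<open>V (2 ^ n)\<close>.\<close>
      then have "z \<in> U (Suc n)" using U_mono[of n "Suc n"] by auto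
      then have "L * z \<in> U n"
        using V_antimono[of "2 ^ n" "2 ^ Suc n"] by (auto simp: U_def mult_ac)
      then have "L * z \<in> Wh" unfolding Wh by blast
      then show "z \<in> (\<lambda>z. z / L) ` Wh" by (intro image_eqI[of _ _ "L * z"]) simp_all
    qed
  qed
qed

end
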